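(* Let $A$ be a skew brace. Then the Baer radical $B(A)$ equals the intersection of all prime ideals of $A$.
   Context: A skew brace is a triple $(A,+,\circ)$ where $(A,+)$ and $(A,\circ)$ are (not necessarily abelian) groups with $a\circ(b+c)=a\circ b-a+a\circ c$ for all $a,b,c\in A$ (the two groups share the identity element $0$). For $a,b\in A$ put $\lambda_a(b)=-a+a\circ b$ and $a*b=\lambda_a(b)-b$. For subsets $X,Y\subseteq A$, $X*Y$ denotes the subgroup of $(A,+)$ generated by $\{x*y:x\in X,\ y\in Y\}$. An ideal of $A$ is a normal subgroup $I$ of $(A,\circ)$ such that $\lambda_a(I)\subseteq I$ and $a+I=I+a$ for all $a\in A$; then $I$ is also a normal subgroup of $(A,+)$, $a+I=a\circ I$, and the quotient $A/I$ is a skew brace. For $a\in A$, $\langle a\rangle$ denotes the smallest ideal of $A$ containing $a$. A skew brace $A$ is prime if $I*J\neq 0$ for all non-zero ideals $I,J$ of $A$ (in particular the zero skew brace is prime). An ideal $P$ of $A$ is prime if $A/P$ is a prime skew brace (in particular $P=A$ is a prime ideal). An $n$-sequence in $A$ is a sequence $a_1,a_2,a_3,\ldots$ of elements of $A$ with $a_{i+1}\in\langle a_i\rangle*\langle a_i\rangle$ for all $i\ge 1$. An ideal $I$ of $A$ is Baer radical if every $n$-sequence in $A$ starting with an element of $I$ reaches zero at some point. The Baer radical $B(A)$ is the largest Baer radical ideal of $A$ (it exists: it is the sum of all Baer radical ideals). *)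

theory Defs
  imports "HOL-Algebra.Generated_Groups" "HOL-Algebra.AbelCoset"
begin

text \<open>
  A skew brace is carried by a record of type \<open>ring\<close>: \<open>\<oplus>\<close> is the additive
  operation (not assumed commutative) and \<open>\<otimes>\<close> is the circle operation.
  Thus \<open>inv\<close> and \<open>\<one>\<close> belong to the circle group, \<open>\<ominus>\<close> and \<open>\<zero>\<close> to the
  additive one; \<open>\<one> = \<zero>\<close> follows from the axioms.
\<close>

locale skew_brace =
  fixes A :: "('a, 'm) ring_scheme" (structure)
  assumes add_group: "group (add_monoid A)"
    and circ_group: "group A"
    and brace: "\<lbrakk>a \<in> carrier A; b \<in> carrier A; c \<in> carrier A\<rbrakk>
      \<Longrightarrow> a \<otimes> (b \<oplus> c) = ((a \<otimes> b) \<ominus> a) \<oplus> (a \<otimes> c)"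

definition lam :: "('a, 'm) ring_scheme \<Rightarrow> 'a \<Rightarrow> 'a \<Rightarrow> 'a" where
  "lam A a b = \<ominus>\<^bsub>A\<^esub> a \<oplus>\<^bsub>A\<^esub> (a \<otimes>\<^bsub>A\<^esub> b)"

definition star :: "('a, 'm) ring_scheme \<Rightarrow> 'a \<Rightarrow> 'a \<Rightarrow> 'a" where
  "star A a b = lam A a b \<ominus>\<^bsub>A\<^esub> b"

definition star_set :: "('a, 'm) ring_scheme \<Rightarrow> 'a set \<Rightarrow> 'a set \<Rightarrow> 'a set" where
  "star_set A X Y = generate (add_monoid A) {star A x y | x y. x \<in> X \<and> y \<in> Y}"

definition brace_ideal :: "('a, 'm) ring_scheme \<Rightarrow> 'a set \<Rightarrow> bool" where
  "brace_ideal A I \<longleftrightarrow>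
     I \<lhd> A \<and>
     (\<forall>a \<in> carrier A. lam A a ` I \<subseteq> I) \<and>
     (\<forall>a \<in> carrier A. a <+\<^bsub>A\<^esub> I = I +>\<^bsub>A\<^esub> a)"

definition ideal_gen :: "('a, 'm) ring_scheme \<Rightarrow> 'a \<Rightarrow> 'a set" where
  "ideal_gen A a = \<Inter>{I. brace_ideal A I \<and> a \<in> I}"

text \<open>
  For an ideal \<open>I\<close>, additive and circle cosets coincide, so the two
  library quotient groups have the same carrier.
\<close>

definition quot_brace :: "('a, 'm) ring_scheme \<Rightarrow> 'a set \<Rightarrow> 'a set ring" where
  "quot_brace A I =
     \<lparr>carrier = carrier (A Mod I),
      mult = mult (A Mod I),
      one = one (A Mod I),
      zero = one (add_monoid A Mod I),
      add = mult (add_monoid A Mod I)\<rparr>"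

definition prime_brace :: "('a, 'm) ring_scheme \<Rightarrow> bool" where
  "prime_brace A \<longleftrightarrow> skew_brace A \<and>
     (\<forall>I J. brace_ideal A I \<and> brace_ideal A J \<and> I \<noteq> {\<zero>\<^bsub>A\<^esub>} \<and> J \<noteq> {\<zero>\<^bsub>A\<^esub>}
        \<longrightarrow> star_set A I J \<noteq> {\<zero>\<^bsub>A\<^esub>})"

definition prime_brace_ideal :: "('a, 'm) ring_scheme \<Rightarrow> 'a set \<Rightarrow> bool" where
  "prime_brace_ideal A P \<longleftrightarrow> brace_ideal A P \<and> prime_brace (quot_brace A P)"

definition n_sequence :: "('a, 'm) ring_scheme \<Rightarrow> (nat \<Rightarrow> 'a) \<Rightarrow> bool" where
  "n_sequence A a \<longleftrightarrow> range a \<subseteq> carrier A \<and>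
     (\<forall>i. a (Suc i) \<in> star_set A (ideal_gen A (a i)) (ideal_gen A (a i)))"

definition baer_radical_ideal :: "('a, 'm) ring_scheme \<Rightarrow> 'a set \<Rightarrow> bool" where
  "baer_radical_ideal A I \<longleftrightarrow> brace_ideal A I \<and>
     (\<forall>a. n_sequence A a \<and> a 0 \<in> I \<longrightarrow> (\<exists>i. a i = \<zero>\<^bsub>A\<^esub>))"

definition baer_radical :: "('a, 'm) ring_scheme \<Rightarrow> 'a set" where
  "baer_radical A = (GREATEST I. baer_radical_ideal A I)"

end

theory Submission
  imports Defs
begin

text \<open>
  The intersection of all prime ideals is shown to be the greatest Baer radical ideal. If an
  \<open>n\<close>-sequence never vanishes, then an ideal that is maximal among those avoiding all of its terms
  is prime: two strictly larger ideals both contain some term \<open>a\<^sub>m\<close>, hence their product contains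
  \<open>a\<^sub>m\<^sub>+\<^sub>1\<close>. Conversely, if \<open>a\<close> lies outside a prime ideal \<open>P\<close>, then \<open>\<langle>a\<rangle> * \<langle>a\<rangle>\<close> is not
  contained in \<open>P\<close>, which allows one to continue an \<open>n\<close>-sequence outside \<open>P\<close> forever.
\<close>

section \<open>The two group structures and the maps \<open>lam A a\<close>\<close>

context skew_brace
begin

sublocale circ: group A
  by (rule circ_group)

text \<open>The rewrites restate the facts about the additive group in terms of
  \<open>carrier A\<close>, \<open>\<oplus>\<close>, \<open>\<zero>\<close> and
  \<open>\<ominus>\<close>, so that they combine directly with those about the circle group.\<close>

sublocale add: group "add_monoid A"
  rewrites "carrier (add_monoid A) = carrier A"
    and "mult (add_monoid A) = add A"
    and "one (add_monoid A) = zero A"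
    and "m_inv (add_monoid A) = a_inv A"
  by (rule add_group) (simp_all add: a_inv_def)

lemma a_inv_add_cancel:
  assumes "a \<in> carrier A" "b \<in> carrier A"
  shows "\<ominus> a \<oplus> (a \<oplus> b) = b" "a \<oplus> (\<ominus> a \<oplus> b) = b"
  using assms by (simp_all flip: add.m_assoc)

text \<open>The brace law at \<open>a = \<one>\<close> and \<open>b = c = \<zero>\<close> collapses
  to \<open>\<zero> = \<ominus> \<one>\<close>.\<close>

lemma one_eq_zero: "\<one> = \<zero>"
proof -
  have "\<one> \<otimes> (\<zero> \<oplus> \<zero>) = ((\<one> \<otimes> \<zero>) \<ominus> \<one>) \<oplus> (\<one> \<otimes> \<zero>)"
    by (rule brace) auto
  then have "\<zero> = \<ominus> \<one>" by (simp add: a_minus_def)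
  then show ?thesis using add.inv_inv add.inv_one by (metis circ.one_closed)
qed

lemma lam_closed [simp]: "a \<in> carrier A \<Longrightarrow> b \<in> carrier A \<Longrightarrow> lam A a b \<in> carrier A"
  by (simp add: lam_def)

lemma minus_closed [simp]: "a \<in> carrier A \<Longrightarrow> b \<in> carrier A \<Longrightarrow> a \<ominus> b \<in> carrier A"
  by (simp add: a_minus_def)

lemma star_closed [simp]: "a \<in> carrier A \<Longrightarrow> b \<in> carrier A \<Longrightarrow> star A a b \<in> carrier A"
  by (simp add: star_def)

lemma circ_eq_add_lam:
  "a \<in> carrier A \<Longrightarrow> b \<in> carrier A \<Longrightarrow> a \<otimes> b = a \<oplus> lam A a b"
  by (simp add: lam_def a_inv_add_cancel)

lemma lam_add:
  assumes "a \<in> carrier A" "b \<in> carrier A" "c \<in> carrier A"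
  shows "lam A a (b \<oplus> c) = lam A a b \<oplus> lam A a c"
  using assms by (simp add: lam_def brace a_minus_def add.m_assoc)

text \<open>Links the two kinds of inverse; closure of an ideal under one of them is derived from
  it.\<close>

lemma lam_inv:
  assumes "a \<in> carrier A"
  shows "lam A a (inv a) = \<ominus> a"
  using assms by (simp add: lam_def one_eq_zero)

text \<open>Expand \<open>(a \<otimes> b) \<otimes> c\<close> in two ways by associativity of
  \<open>\<otimes>\<close> and additivity of \<open>lam A a\<close>, then cancel
  \<open>a \<otimes> b\<close> additively.\<close>

lemma lam_circ:
  assumes "a \<in> carrier A" "b \<in> carrier A" "c \<in> carrier A"
  shows "lam A (a \<otimes> b) c = lam A a (lam A b c)"
proof -
  have "(a \<otimes> b) \<oplus> lam A (a \<otimes> b) c = a \<otimes> (b \<otimes> c)"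
    using assms by (simp add: circ.m_assoc flip: circ_eq_add_lam)
  also have "\<dots> = a \<oplus> lam A a (b \<oplus> lam A b c)"
    using assms by (simp add: circ_eq_add_lam)
  also have "\<dots> = (a \<otimes> b) \<oplus> lam A a (lam A b c)"
    using assms by (simp add: circ_eq_add_lam lam_add add.m_assoc)
  finally show ?thesis using assms by simp
qed

lemma lam_zero: "b \<in> carrier A \<Longrightarrow> lam A \<zero> b = b"
  using circ.l_one[of b] by (simp add: lam_def one_eq_zero)

text \<open>\<open>lam A (inv a)\<close> inverts \<open>lam A a\<close>, so
  \<open>circ_eq_add_lam\<close> can be solved for the sum.\<close>

lemma add_eq_circ_lam:
  assumes "a \<in> carrier A" "b \<in> carrier A"
  shows "a \<oplus> b = a \<otimes> lam A (inv a) b"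
proof -
  have "a \<otimes> lam A (inv a) b = a \<oplus> lam A a (lam A (inv a) b)"
    using assms by (simp add: circ_eq_add_lam)
  also have "lam A a (lam A (inv a) b) = lam A (a \<otimes> inv a) b"
    using assms by (intro lam_circ [symmetric]) auto
  also have "\<dots> = b" using assms by (simp add: one_eq_zero lam_zero)
  finally show ?thesis ..
qed

section \<open>Ideals and their elementwise description\<close>

text \<open>The definition supplies a subgroup only of the circle group. The additive subgroup comes
  from invariance under \<open>lam\<close>, which turns sums and negatives into circle products and
  \<open>lam\<close> values.\<close>

lemma brace_idealD:
  assumes "brace_ideal A I"
  shows "I \<subseteq> carrier A" "\<zero> \<in> I" "subgroup I (add_monoid A)"
    "a \<in> carrier A \<Longrightarrow> x \<in> I \<Longrightarrow> lam A a x \<in> I"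
    "a \<in> carrier A \<Longrightarrow> x \<in> I \<Longrightarrow> a \<oplus> x \<ominus> a \<in> I"
    "a \<in> carrier A \<Longrightarrow> x \<in> I \<Longrightarrow> a \<otimes> x \<otimes> inv a \<in> I"
proof -
  have nrm: "I \<lhd> A" and lam: "\<And>a x. a \<in> carrier A \<Longrightarrow> x \<in> I \<Longrightarrow> lam A a x \<in> I"
    and cos: "\<And>a. a \<in> carrier A \<Longrightarrow> a <+ I = I +> a"
    using assms by (auto simp: brace_ideal_def)
  interpret I: normal I A by (rule nrm)
  show sub: "I \<subseteq> carrier A" by (rule I.subset)
  show zero: "\<zero> \<in> I" using I.one_closed by (simp add: one_eq_zero)
  show "a \<in> carrier A \<Longrightarrow> x \<in> I \<Longrightarrow> lam A a x \<in> I" by (rule lam)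
  show "a \<in> carrier A \<Longrightarrow> x \<in> I \<Longrightarrow> a \<otimes> x \<otimes> inv a \<in> I" by (rule I.inv_op_closed2)
  show "subgroup I (add_monoid A)"
  proof (rule add.subgroupI)
    fix x y assume x: "x \<in> I" and y: "y \<in> I"
    have "\<ominus> x = lam A x (inv x)" using x sub by (auto simp: lam_inv)
    then show "\<ominus> x \<in> I" using lam x sub by auto
    have "x \<oplus> y = x \<otimes> lam A (inv x) y" using x y sub by (auto intro: add_eq_circ_lam)
    then show "x \<oplus> y \<in> I" using lam x y sub by auto
  qed (use sub zero in auto)
  assume a: "a \<in> carrier A" and x: "x \<in> I"
  \<comment> \<open>Equality of cosets moves \<open>a\<close> to the right of some \<open>y\<close>
    in \<open>I\<close>; this \<open>y\<close> is the additive conjugate of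
    \<open>x\<close>.\<close>
  have "a \<oplus> x \<in> I +> a" using x cos[OF a] by (force simp: a_l_coset_def l_coset_def)
  then obtain y where "y \<in> I" "a \<oplus> x = y \<oplus> a" by (auto simp: a_r_coset_def r_coset_def)
  then show "a \<oplus> x \<ominus> a \<in> I" using a sub by (auto simp: a_minus_def add.m_assoc)
qed

text \<open>A converse to \<open>brace_idealD\<close>, starting from an additive subgroup: the
  circle subgroup and the coset equality are recovered from closure under \<open>lam\<close> and
  conjugation.\<close>

lemma brace_idealI:
  assumes sub: "I \<subseteq> carrier A" and "subgroup I (add_monoid A)"
    and lam: "\<And>a x. a \<in> carrier A \<Longrightarrow> x \<in> I \<Longrightarrow> lam A a x \<in> I"
    and add: "\<And>a x. a \<in> carrier A \<Longrightarrow> x \<in> I \<Longrightarrow> a \<oplus> x \<ominus> a \<in> I"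
    and circ: "\<And>a x. a \<in> carrier A \<Longrightarrow> x \<in> I \<Longrightarrow> a \<otimes> x \<otimes> inv a \<in> I"
  shows "brace_ideal A I"
proof -
  interpret I: subgroup I "add_monoid A" by fact
  have zero: "\<zero> \<in> I" using I.one_closed by simp
  have plus: "x \<oplus> y \<in> I" if "x \<in> I" "y \<in> I" for x y using I.m_closed that by simp
  have minus: "\<ominus> x \<in> I" if "x \<in> I" for x using I.m_inv_closed that by (simp add: a_inv_def)
  have "subgroup I A"
  proof (rule circ.subgroupI)
    fix x y assume x: "x \<in> I" and y: "y \<in> I"
    then have c: "x \<in> carrier A" "y \<in> carrier A" using sub by auto
    \<comment> \<open>\<open>lam_inv\<close> at \<open>inv x\<close> exhibits the circle inverse as
      the negative of a \<open>lam\<close> value, which lies in \<open>I\<close>.\<close>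
    have "lam A (inv x) x = \<ominus> (inv x)" using lam_inv[of "inv x"] c by simp
    then have "\<ominus> lam A (inv x) x = inv x" using c by simp
    then show "inv x \<in> I" using minus[OF lam[of "inv x" x]] x c by simp
    show "x \<otimes> y \<in> I" using x y c lam plus by (simp add: circ_eq_add_lam)
  qed (use sub zero in auto)
  then have "I \<lhd> A" using circ by (simp add: circ.normal_inv_iff)
  moreover have "a <+ I = I +> a" if a: "a \<in> carrier A" for a
  proof -
    have "a \<oplus> x \<in> I +> a" if x: "x \<in> I" for x
    proof -
      have "a \<oplus> x = (a \<oplus> x \<ominus> a) \<oplus> a"
        using a subsetD[OF sub x] by (simp add: a_minus_def add.m_assoc)
      then show ?thesis using add[OF a x] by (auto simp: a_r_coset_def r_coset_def)
    qed
    moreover have "x \<oplus> a \<in> a <+ I" if x: "x \<in> I" for x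
    proof -
      \<comment> \<open>The reverse inclusion conjugates by \<open>\<ominus> a\<close> instead of
        \<open>a\<close>.\<close>
      have "x \<oplus> a = a \<oplus> (\<ominus> a \<oplus> x \<ominus> (\<ominus> a))"
        using a subsetD[OF sub x] by (simp add: a_minus_def add.m_assoc a_inv_add_cancel)
      then show ?thesis using add[of "\<ominus> a" x] a x by (auto simp: a_l_coset_def l_coset_def)
    qed
    ultimately show ?thesis
      by (auto simp: a_l_coset_def l_coset_def a_r_coset_def r_coset_def)
  qed
  ultimately show ?thesis using lam by (auto simp: brace_ideal_def)
qed

lemma brace_ideal_a_normal:
  assumes "brace_ideal A I"
  shows "I \<lhd> add_monoid A"
  unfolding add.normal_inv_iff using brace_idealD[OF assms] by (simp add: a_minus_def)

text \<open>Normality on each side reduces the claim to left cosets, where \<open>lam A a\<close>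
  and \<open>lam A (inv a)\<close> translate between \<open>a \<otimes> x\<close> and
  \<open>a \<oplus> y\<close>. This makes the two quotient groups share a carrier.\<close>

lemma brace_ideal_cosets_eq:
  assumes I: "brace_ideal A I" and a: "a \<in> carrier A"
  shows "I #> a = I +> a"
proof -
  note D = brace_idealD[OF I]
  have "I \<lhd> A" using I by (simp add: brace_ideal_def)
  then have "I #> a = a <# I" using a by (simp add: normal.coset_eq)
  also have "\<dots> = a <+ I"
  proof -
    have "\<exists>y\<in>I. a \<otimes> x = a \<oplus> y" if "x \<in> I" for x
      using that a D(1,4) by (auto intro!: bexI[of _ "lam A a x"] circ_eq_add_lam)
    moreover have "\<exists>y\<in>I. a \<oplus> x = a \<otimes> y" if "x \<in> I" for x
      using that a D(1,4) by (auto intro!: bexI[of _ "lam A (inv a) x"] add_eq_circ_lam)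
    ultimately show ?thesis by (auto simp: a_l_coset_def l_coset_def)
  qed
  also have "\<dots> = I +> a" using I a by (simp add: brace_ideal_def)
  finally show ?thesis .
qed

lemma brace_ideal_carrier: "brace_ideal A (carrier A)"
  by (rule brace_idealI) (auto simp: a_minus_def intro: add.subgroup_self)

lemma brace_ideal_zero: "brace_ideal A {\<zero>}"
proof (rule brace_idealI)
  have "lam A a \<zero> = \<zero>" if a: "a \<in> carrier A" for a
    using lam_add[OF a, of \<zero> \<zero>] a by simp
  then show "lam A a x \<in> {\<zero>}" if "a \<in> carrier A" "x \<in> {\<zero>}" for a x using that by simp
  show "a \<otimes> x \<otimes> inv a \<in> {\<zero>}" if "a \<in> carrier A" "x \<in> {\<zero>}" for a x
    using that by (simp flip: one_eq_zero)
qed (use add.triv_subgroup in \<open>auto simp: a_minus_def\<close>)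

lemma brace_ideal_Inter:
  assumes "\<I> \<noteq> {}" and "\<And>I. I \<in> \<I> \<Longrightarrow> brace_ideal A I"
  shows "brace_ideal A (\<Inter>\<I>)"
proof (rule brace_idealI)
  note D = brace_idealD[OF assms(2)]
  show "\<Inter>\<I> \<subseteq> carrier A" using assms(1) D(1) by blast
  show "subgroup (\<Inter>\<I>) (add_monoid A)" using assms(1) D(3) by (intro add.subgroups_Inter)
  fix a x assume "a \<in> carrier A" "x \<in> \<Inter>\<I>"
  then show "lam A a x \<in> \<Inter>\<I>" "a \<oplus> x \<ominus> a \<in> \<Inter>\<I>" "a \<otimes> x \<otimes> inv a \<in> \<Inter>\<I>"
    using D(4-6)[of _ a x] by simp_all
qed

text \<open>Supplies the upper bounds for Zorn's lemma.\<close>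

lemma brace_ideal_Union_chain:
  assumes "\<C> \<noteq> {}" and "\<And>I. I \<in> \<C> \<Longrightarrow> brace_ideal A I" and chain: "subset.chain UNIV \<C>"
  shows "brace_ideal A (\<Union>\<C>)"
proof (rule brace_idealI)
  note D = brace_idealD[OF assms(2)]
  show sub: "\<Union>\<C> \<subseteq> carrier A" using D(1) by blast
  show "subgroup (\<Union>\<C>) (add_monoid A)"
  proof (rule add.subgroupI)
    show "\<Union>\<C> \<noteq> {}" using assms(1) D(2) by blast
    fix x y assume "x \<in> \<Union>\<C>" "y \<in> \<Union>\<C>"
    \<comment> \<open>Of the two members containing \<open>x\<close> and \<open>y\<close>, the
      larger one contains both.\<close>
    then obtain I where I: "I \<in> \<C>" "x \<in> I" "y \<in> I"
      using chain by (fastforce simp: subset_chain_def)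
    interpret I: subgroup I "add_monoid A" by (rule D(3)) fact
    show "x \<oplus> y \<in> \<Union>\<C>" "\<ominus> x \<in> \<Union>\<C>"
      using I I.m_closed I.m_inv_closed by (auto simp: a_inv_def)
  qed (rule sub)
  fix a x assume a: "a \<in> carrier A" and "x \<in> \<Union>\<C>"
  then obtain I where I: "I \<in> \<C>" "x \<in> I" by blast
  show "lam A a x \<in> \<Union>\<C>" "a \<oplus> x \<ominus> a \<in> \<Union>\<C>" "a \<otimes> x \<otimes> inv a \<in> \<Union>\<C>"
    using D(4-6)[OF I(1) a I(2)] I(1) by blast+
qed

lemma brace_ideal_ideal_gen:
  assumes "a \<in> carrier A" shows "brace_ideal A (ideal_gen A a)"
  unfolding ideal_gen_def using assms brace_ideal_carrier by (intro brace_ideal_Inter) auto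

lemma ideal_gen_self: "a \<in> ideal_gen A a"
  by (simp add: ideal_gen_def)

lemma ideal_gen_least: "brace_ideal A I \<Longrightarrow> a \<in> I \<Longrightarrow> ideal_gen A a \<subseteq> I"
  by (auto simp: ideal_gen_def)

section \<open>Star products of subsets\<close>

lemma star_set_mono:
  assumes "X \<subseteq> X'" "Y \<subseteq> Y'"
  shows "star_set A X Y \<subseteq> star_set A X' Y'"
  unfolding star_set_def using assms by (intro add.mono_generate) blast

lemma star_set_subset_iff:
  assumes "subgroup H (add_monoid A)"
  shows "star_set A X Y \<subseteq> H \<longleftrightarrow> (\<forall>x\<in>X. \<forall>y\<in>Y. star A x y \<in> H)"
proof
  have "star A x y \<in> star_set A X Y" if "x \<in> X" "y \<in> Y" for x y
    unfolding star_set_def using that by (intro generate.incl) blast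
  then show "\<forall>x\<in>X. \<forall>y\<in>Y. star A x y \<in> H" if "star_set A X Y \<subseteq> H"
    using that by blast
  show "star_set A X Y \<subseteq> H" if "\<forall>x\<in>X. \<forall>y\<in>Y. star A x y \<in> H"
    unfolding star_set_def using that by (intro add.generate_subgroup_incl assms) blast
qed

lemma star_set_eq_zero_iff:
  "star_set A X Y = {\<zero>} \<longleftrightarrow> (\<forall>x\<in>X. \<forall>y\<in>Y. star A x y = \<zero>)"
proof -
  \<comment> \<open>The generated subgroup contains \<open>\<zero>\<close> even if \<open>X\<close>
    or \<open>Y\<close> is empty.\<close>
  have "\<zero> \<in> star_set A X Y"
    unfolding star_set_def using generate.one[of "add_monoid A"] by simp
  then have "star_set A X Y = {\<zero>} \<longleftrightarrow> star_set A X Y \<subseteq> {\<zero>}" by auto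
  then show ?thesis
    using star_set_subset_iff[OF brace_idealD(3)[OF brace_ideal_zero]] by simp
qed

lemma star_set_ideal_subset:
  assumes "brace_ideal A I"
  shows "star_set A I I \<subseteq> I"
proof -
  note D = brace_idealD[OF assms]
  interpret I: subgroup I "add_monoid A" by (rule D(3))
  have "star A x y \<in> I" if "x \<in> I" "y \<in> I" for x y
    using D(4)[OF subsetD[OF D(1)]] that I.m_closed I.m_inv_closed[of y]
    by (simp add: star_def a_minus_def flip: a_inv_def)
  then show ?thesis by (simp add: star_set_subset_iff[OF D(3)])
qed

end

section \<open>Surjective homomorphisms of skew braces\<close>

text \<open>An abstract setting for the projection onto a quotient: primeness of \<open>B\<close> is
  translated into ideals of \<open>A\<close> without computing with cosets.\<close>

locale skew_brace_epi = A: skew_brace A + B: skew_brace B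
  for A :: "('a, 'm) ring_scheme" (structure) and B :: "('b, 'n) ring_scheme" +
  fixes h :: "'a \<Rightarrow> 'b"
  assumes circ_hom: "h \<in> hom A B"
    and add_hom: "h \<in> hom (add_monoid A) (add_monoid B)"
    and surj: "h ` carrier A = carrier B"
begin

lemma h_closed [simp]: "x \<in> carrier A \<Longrightarrow> h x \<in> carrier B"
  using surj by auto

lemma h_circ: "x \<in> carrier A \<Longrightarrow> y \<in> carrier A \<Longrightarrow> h (x \<otimes> y) = h x \<otimes>\<^bsub>B\<^esub> h y"
  using circ_hom by (rule hom_mult)

lemma h_add: "x \<in> carrier A \<Longrightarrow> y \<in> carrier A \<Longrightarrow> h (x \<oplus> y) = h x \<oplus>\<^bsub>B\<^esub> h y"
  using hom_mult[OF add_hom, of x y] by simp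

lemma h_inv: "x \<in> carrier A \<Longrightarrow> h (inv x) = inv\<^bsub>B\<^esub> h x"
  using group_hom.hom_inv[of A B h x] circ_hom A.circ_group B.circ_group
  by (simp add: group_hom_def group_hom_axioms_def)

lemma add_group_hom: "group_hom (add_monoid A) (add_monoid B) h"
  using add_hom A.add_group B.add_group by (simp add: group_hom_def group_hom_axioms_def)

lemma h_a_inv: "x \<in> carrier A \<Longrightarrow> h (\<ominus> x) = \<ominus>\<^bsub>B\<^esub> h x"
  using group_hom.hom_inv[OF add_group_hom, of x] by (simp add: a_inv_def)

lemma h_zero: "h \<zero> = \<zero>\<^bsub>B\<^esub>"
  using group_hom.hom_one[OF add_group_hom] by simp

lemma h_minus: "x \<in> carrier A \<Longrightarrow> y \<in> carrier A \<Longrightarrow> h (x \<ominus> y) = h x \<ominus>\<^bsub>B\<^esub> h y"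
  by (simp add: a_minus_def h_add h_a_inv)

lemma h_lam: "x \<in> carrier A \<Longrightarrow> y \<in> carrier A \<Longrightarrow> h (lam A x y) = lam B (h x) (h y)"
  by (simp add: lam_def h_add h_a_inv h_circ)

lemma h_star: "x \<in> carrier A \<Longrightarrow> y \<in> carrier A \<Longrightarrow> h (star A x y) = star B (h x) (h y)"
  by (simp add: star_def h_minus h_lam)

lemma brace_ideal_image:
  assumes "brace_ideal A I"
  shows "brace_ideal B (h ` I)"
proof (rule B.brace_idealI)
  note D = A.brace_idealD[OF assms]
  show "h ` I \<subseteq> carrier B" using D(1) by auto
  show "subgroup (h ` I) (add_monoid B)"
    by (rule group_hom.subgroup_img_is_subgroup[OF add_group_hom D(3)])
  fix b y assume "b \<in> carrier B" "y \<in> h ` I"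
  then obtain a x where ax: "a \<in> carrier A" "b = h a" "x \<in> I" "y = h x"
    using surj by blast
  then have "x \<in> carrier A" using D(1) by auto
  with ax have "lam B b y = h (lam A a x)" "b \<oplus>\<^bsub>B\<^esub> y \<ominus>\<^bsub>B\<^esub> b = h (a \<oplus> x \<ominus> a)"
    "b \<otimes>\<^bsub>B\<^esub> y \<otimes>\<^bsub>B\<^esub> inv\<^bsub>B\<^esub> b = h (a \<otimes> x \<otimes> inv a)"
    by (simp_all add: h_lam h_add h_minus h_circ h_inv)
  then show "lam B b y \<in> h ` I" "b \<oplus>\<^bsub>B\<^esub> y \<ominus>\<^bsub>B\<^esub> b \<in> h ` I" "b \<otimes>\<^bsub>B\<^esub> y \<otimes>\<^bsub>B\<^esub> inv\<^bsub>B\<^esub> b \<in> h ` I"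
    using D(4-6)[OF ax(1,3)] by simp_all
qed

lemma brace_ideal_vimage:
  assumes "brace_ideal B K"
  shows "brace_ideal A {x \<in> carrier A. h x \<in> K}"
proof (rule A.brace_idealI)
  note D = B.brace_idealD[OF assms]
  interpret K: subgroup K "add_monoid B" by (rule D(3))
  show "subgroup {x \<in> carrier A. h x \<in> K} (add_monoid A)"
  proof (rule A.add.subgroupI)
    have "\<zero> \<in> {x \<in> carrier A. h x \<in> K}" using D(2) by (simp add: h_zero)
    then show "{x \<in> carrier A. h x \<in> K} \<noteq> {}" by blast
    fix x y assume "x \<in> {x \<in> carrier A. h x \<in> K}" "y \<in> {x \<in> carrier A. h x \<in> K}"
    then show "\<ominus> x \<in> {x \<in> carrier A. h x \<in> K}" "x \<oplus> y \<in> {x \<in> carrier A. h x \<in> K}"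
      using K.m_inv_closed[of "h x"] K.m_closed[of "h x" "h y"]
      by (simp_all add: h_add h_a_inv flip: a_inv_def)
  qed blast
  fix a x assume a: "a \<in> carrier A" and "x \<in> {x \<in> carrier A. h x \<in> K}"
  then have x: "x \<in> carrier A" "h x \<in> K" by auto
  show "lam A a x \<in> {x \<in> carrier A. h x \<in> K}" "a \<oplus> x \<ominus> a \<in> {x \<in> carrier A. h x \<in> K}"
    "a \<otimes> x \<otimes> inv a \<in> {x \<in> carrier A. h x \<in> K}"
    using D(4-6)[of "h a" "h x"] a x by (simp_all add: h_lam h_add h_minus h_circ h_inv)
qed auto

lemma mem_a_kernel_iff: "x \<in> a_kernel A B h \<longleftrightarrow> x \<in> carrier A \<and> h x = \<zero>\<^bsub>B\<^esub>"
  by (auto simp: a_kernel_def')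

text \<open>The kernel is an additive subgroup, so only the generators matter, and \<open>h\<close>
  commutes with \<open>star\<close>.\<close>

lemma star_set_subset_a_kernel_iff:
  assumes "X \<subseteq> carrier A" "Y \<subseteq> carrier A"
  shows "star_set A X Y \<subseteq> a_kernel A B h \<longleftrightarrow> star_set B (h ` X) (h ` Y) = {\<zero>\<^bsub>B\<^esub>}"
proof -
  have "subgroup (a_kernel A B h) (add_monoid A)"
    using group_hom.subgroup_kernel[OF add_group_hom] by (simp add: a_kernel_def)
  moreover have "star A x y \<in> a_kernel A B h \<longleftrightarrow> star B (h x) (h y) = \<zero>\<^bsub>B\<^esub>"
    if "x \<in> X" "y \<in> Y" for x y
    using subsetD[OF assms(1) that(1)] subsetD[OF assms(2) that(2)]
    by (simp add: mem_a_kernel_iff h_star)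
  ultimately show ?thesis by (simp add: A.star_set_subset_iff B.star_set_eq_zero_iff)
qed

lemma ideal_subset_a_kernel_iff:
  assumes "brace_ideal A I"
  shows "I \<subseteq> a_kernel A B h \<longleftrightarrow> h ` I = {\<zero>\<^bsub>B\<^esub>}"
proof
  note D = A.brace_idealD[OF assms]
  show "h ` I = {\<zero>\<^bsub>B\<^esub>}" if "I \<subseteq> a_kernel A B h"
    using that D(2) by (force simp: mem_a_kernel_iff)
  show "I \<subseteq> a_kernel A B h" if "h ` I = {\<zero>\<^bsub>B\<^esub>}"
    using that D(1) unfolding mem_a_kernel_iff subset_iff by blast
qed

text \<open>Ideals of \<open>B\<close> are pulled back to \<open>A\<close>. Preimages contain the
  kernel, so the hypothesis need only concern ideals above it.\<close>

lemma prime_codomainI: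
  assumes "\<And>I J. brace_ideal A I \<Longrightarrow> brace_ideal A J \<Longrightarrow>
      a_kernel A B h \<subseteq> I \<Longrightarrow> a_kernel A B h \<subseteq> J \<Longrightarrow> star_set A I J \<subseteq> a_kernel A B h \<Longrightarrow>
      I \<subseteq> a_kernel A B h \<or> J \<subseteq> a_kernel A B h"
  shows "prime_brace B"
  unfolding prime_brace_def
proof (intro conjI allI impI B.skew_brace_axioms)
  fix K L
  assume KL: "brace_ideal B K \<and> brace_ideal B L \<and> K \<noteq> {\<zero>\<^bsub>B\<^esub>} \<and> L \<noteq> {\<zero>\<^bsub>B\<^esub>}"
  define I J where "I = {x \<in> carrier A. h x \<in> K}" and "J = {x \<in> carrier A. h x \<in> L}"
  have zero: "\<zero>\<^bsub>B\<^esub> \<in> K" "\<zero>\<^bsub>B\<^esub> \<in> L" and sub: "K \<subseteq> carrier B" "L \<subseteq> carrier B"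
    using KL B.brace_idealD(1,2) by blast+
  have IJ: "brace_ideal A I" "brace_ideal A J"
    unfolding I_def J_def using KL by (blast intro: brace_ideal_vimage)+
  have img: "h ` I = K" "h ` J = L"
    using sub unfolding I_def J_def surj[symmetric] by blast+
  show "star_set B K L \<noteq> {\<zero>\<^bsub>B\<^esub>}"
  proof
    assume "star_set B K L = {\<zero>\<^bsub>B\<^esub>}"
    then have "star_set A I J \<subseteq> a_kernel A B h"
      using IJ[THEN A.brace_idealD(1)] by (simp add: star_set_subset_a_kernel_iff img)
    moreover have "a_kernel A B h \<subseteq> I" "a_kernel A B h \<subseteq> J"
      using zero by (auto simp: mem_a_kernel_iff I_def J_def)
    ultimately have "I \<subseteq> a_kernel A B h \<or> J \<subseteq> a_kernel A B h"
      using IJ by (intro assms)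
    then show False using KL by (simp add: ideal_subset_a_kernel_iff IJ img)
  qed
qed

text \<open>Here ideals are pushed forward, so \<open>I\<close> and \<open>J\<close> need not
  contain the kernel.\<close>

lemma prime_codomainD:
  assumes "prime_brace B" "brace_ideal A I" "brace_ideal A J"
    and "star_set A I J \<subseteq> a_kernel A B h"
  shows "I \<subseteq> a_kernel A B h \<or> J \<subseteq> a_kernel A B h"
proof -
  have "star_set B (h ` I) (h ` J) = {\<zero>\<^bsub>B\<^esub>}"
    using assms(2,3)[THEN A.brace_idealD(1)] assms(4) by (simp add: star_set_subset_a_kernel_iff)
  then show ?thesis
    using assms(1) brace_ideal_image[OF assms(2)] brace_ideal_image[OF assms(3)]
    unfolding prime_brace_def ideal_subset_a_kernel_iff[OF assms(2)]
      ideal_subset_a_kernel_iff[OF assms(3)] by blast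
qed

end

section \<open>Quotients and prime ideals\<close>

context skew_brace
begin

text \<open>Each operation of the quotient comes from a library factor group; agreement of the
  cosets lets one map \<open>a \<mapsto> P +> a\<close> be a homomorphism for both.\<close>

lemma skew_brace_epi_quot:
  assumes P: "brace_ideal A P"
  shows "skew_brace_epi A (quot_brace A P) (\<lambda>a. P +> a)"
proof -
  let ?Q = "quot_brace A P" and ?h = "\<lambda>a. P +> a"
  interpret c: normal P A using P by (simp add: brace_ideal_def)
  interpret a: normal P "add_monoid A" by (rule brace_ideal_a_normal[OF P])
  have eq: "P #> a = P +> a" if "a \<in> carrier A" for a by (rule brace_ideal_cosets_eq[OF P that])
  have carr: "carrier ?Q = ?h ` carrier A"
    using eq by (force simp: quot_brace_def FactGroup_def RCOSETS_def)
  have carr': "carrier (A Mod P) = ?h ` carrier A"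
    "carrier (add_monoid A Mod P) = ?h ` carrier A"
    using eq by (force simp: FactGroup_def RCOSETS_def a_r_coset_def)+
  have grp: "group ?Q"
    \<comment> \<open>The factor group and \<open>?Q\<close> are different records with the same
      carrier, product and unit, so the group axioms are unfolded to transfer them.\<close>
    using c.factorgroup_is_group carr carr'
    by (simp add: group_def monoid_def group_axioms_def Units_def quot_brace_def)
  have agrp: "group (add_monoid ?Q)"
    using a.factorgroup_is_group carr carr'
    by (simp add: group_def monoid_def group_axioms_def Units_def quot_brace_def)
  have hc: "?h \<in> hom A ?Q"
  proof (rule homI)
    show "?h (x \<otimes> y) = ?h x \<otimes>\<^bsub>?Q\<^esub> ?h y" if "x \<in> carrier A" "y \<in> carrier A" for x y
      using hom_mult[OF c.r_coset_hom_Mod that] that eq by (simp add: quot_brace_def)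
  qed (simp add: carr)
  have ha: "?h \<in> hom (add_monoid A) (add_monoid ?Q)"
    using a.r_coset_hom_Mod carr'(2) carr
    by (simp add: hom_def quot_brace_def a_r_coset_def)
  have inv: "?h (\<ominus> x) = \<ominus>\<^bsub>?Q\<^esub> ?h x" if "x \<in> carrier A" for x
    using group_hom.hom_inv[of "add_monoid A" "add_monoid ?Q" ?h x] ha agrp add_group that
    by (simp add: group_hom_def group_hom_axioms_def a_inv_def)
  have hcirc: "?h (x \<otimes> y) = ?h x \<otimes>\<^bsub>?Q\<^esub> ?h y" and hadd: "?h (x \<oplus> y) = ?h x \<oplus>\<^bsub>?Q\<^esub> ?h y"
    if "x \<in> carrier A" "y \<in> carrier A" for x y
    using hom_mult[OF hc that] hom_mult[OF ha, of x y] that by simp_all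
  have "skew_brace ?Q"
  proof (intro skew_brace.intro agrp grp)
    fix u v w assume "u \<in> carrier ?Q" "v \<in> carrier ?Q" "w \<in> carrier ?Q"
    then obtain x y z where xyz: "x \<in> carrier A" "y \<in> carrier A" "z \<in> carrier A"
      "u = ?h x" "v = ?h y" "w = ?h z" by (auto simp: carr)
    \<comment> \<open>The brace law for representatives, pushed through the projection, yields the
      law for cosets.\<close>
    have "?h (x \<otimes> (y \<oplus> z)) = ?h (((x \<otimes> y) \<ominus> x) \<oplus> (x \<otimes> z))"
      using xyz by (simp add: brace)
    then show "u \<otimes>\<^bsub>?Q\<^esub> (v \<oplus>\<^bsub>?Q\<^esub> w) = ((u \<otimes>\<^bsub>?Q\<^esub> v) \<ominus>\<^bsub>?Q\<^esub> u) \<oplus>\<^bsub>?Q\<^esub> (u \<otimes>\<^bsub>?Q\<^esub> w)"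
      using xyz by (simp add: hcirc hadd inv a_minus_def)
  qed
  then show ?thesis
    using hc ha carr
    by (simp add: skew_brace_epi_def skew_brace_epi_axioms_def skew_brace_axioms)
qed

lemma a_kernel_quot:
  assumes P: "brace_ideal A P"
  shows "a_kernel A (quot_brace A P) (\<lambda>a. P +> a) = P"
proof -
  note D = brace_idealD[OF P]
  have "P +> a = P \<longleftrightarrow> a \<in> P" if "a \<in> carrier A" for a
    using add.coset_join1[of P a] add.coset_join2[of a P] D(1,3) that
    by (auto simp: a_r_coset_def)
  then show ?thesis using D(1) by (auto simp: a_kernel_def' quot_brace_def)
qed

text \<open>Primeness is tested inside \<open>A\<close>, on ideals above \<open>P\<close> only; this
  is the form that a maximality argument can use.\<close>

lemma prime_brace_idealI:
  assumes P: "brace_ideal A P"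
    and "\<And>I J. brace_ideal A I \<Longrightarrow> brace_ideal A J \<Longrightarrow> P \<subseteq> I \<Longrightarrow> P \<subseteq> J \<Longrightarrow>
      star_set A I J \<subseteq> P \<Longrightarrow> I \<subseteq> P \<or> J \<subseteq> P"
  shows "prime_brace_ideal A P"
  using skew_brace_epi.prime_codomainI[OF skew_brace_epi_quot[OF P]] assms
  by (simp add: prime_brace_ideal_def a_kernel_quot)

lemma prime_brace_idealD:
  assumes "prime_brace_ideal A P" "brace_ideal A I" "brace_ideal A J" "star_set A I J \<subseteq> P"
  shows "I \<subseteq> P \<or> J \<subseteq> P"
proof -
  have P: "brace_ideal A P" using assms(1) by (simp add: prime_brace_ideal_def)
  show ?thesis
    using skew_brace_epi.prime_codomainD[OF skew_brace_epi_quot[OF P]] assms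
    by (simp add: prime_brace_ideal_def a_kernel_quot)
qed

lemma prime_brace_ideal_carrier: "prime_brace_ideal A (carrier A)"
  by (rule prime_brace_idealI[OF brace_ideal_carrier]) (simp add: brace_idealD)

section \<open>Sequences and prime ideals\<close>

text \<open>If \<open>a k\<close> lies in \<open>I\<close>, the next term lies in
  \<open>star_set A I I\<close>, hence again in \<open>I\<close>.\<close>

lemma n_sequence_mem_ideal_mono:
  assumes a: "n_sequence A a" and I: "brace_ideal A I" and "a i \<in> I" "i \<le> j"
  shows "a j \<in> I"
  using \<open>i \<le> j\<close>
proof (induction rule: dec_induct)
  case (step k)
  then have "ideal_gen A (a k) \<subseteq> I" by (intro ideal_gen_least I)
  then have "star_set A (ideal_gen A (a k)) (ideal_gen A (a k)) \<subseteq> star_set A I I"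
    by (intro star_set_mono)
  also have "\<dots> \<subseteq> I" by (rule star_set_ideal_subset[OF I])
  finally show ?case using a unfolding n_sequence_def by blast
qed (rule \<open>a i \<in> I\<close>)

lemma prime_ideal_avoiding_n_sequence:
  assumes a: "n_sequence A a" and nz: "\<And>i. a i \<noteq> \<zero>"
  obtains P where "prime_brace_ideal A P" "range a \<inter> P = {}"
proof -
  define \<F> where "\<F> = {I. brace_ideal A I \<and> range a \<inter> I = {}}"
  have "\<zero> \<notin> range a" using nz by (metis rangeE)
  \<comment> \<open>This is where non-vanishing enters: it makes the family for Zorn's lemma
    nonempty.\<close>
  then have "{\<zero>} \<in> \<F>" using brace_ideal_zero by (simp add: \<F>_def)
  then have "\<F> \<noteq> {}" by blast
  moreover have "\<Union>\<C> \<in> \<F>" if "\<C> \<noteq> {}" "subset.chain \<F> \<C>" for \<C>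
  proof -
    have \<C>: "\<C> \<subseteq> \<F>" "subset.chain UNIV \<C>" using that(2) by (simp_all add: subset_chain_def)
    have "brace_ideal A I" "range a \<inter> I = {}" if "I \<in> \<C>" for I
      using subsetD[OF \<C>(1) that] by (simp_all add: \<F>_def)
    then have "brace_ideal A (\<Union>\<C>)" "range a \<inter> \<Union>\<C> = {}"
      using brace_ideal_Union_chain[OF \<open>\<C> \<noteq> {}\<close> _ \<C>(2)] by (simp, blast)
    then show ?thesis by (simp add: \<F>_def)
  qed
  ultimately have "\<exists>P\<in>\<F>. \<forall>I\<in>\<F>. P \<subseteq> I \<longrightarrow> I = P" by (rule subset_Zorn_nonempty)
  then obtain P where "P \<in> \<F>" and max: "\<And>I. I \<in> \<F> \<Longrightarrow> P \<subseteq> I \<Longrightarrow> I = P" by blast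
  then have P: "brace_ideal A P" "range a \<inter> P = {}" by (simp_all add: \<F>_def)
  have meets: "\<exists>i. a i \<in> I" if "brace_ideal A I" "P \<subseteq> I" "\<not> I \<subseteq> P" for I
  proof (rule ccontr)
    assume "\<nexists>i. a i \<in> I"
    then have "I \<in> \<F>" using that(1) unfolding \<F>_def by blast
    then show False using max that by blast
  qed
  have "prime_brace_ideal A P"
  proof (rule prime_brace_idealI[OF P(1)], rule ccontr)
    fix I J assume I: "brace_ideal A I" "P \<subseteq> I" and J: "brace_ideal A J" "P \<subseteq> J"
      and IJ: "star_set A I J \<subseteq> P" and "\<not> (I \<subseteq> P \<or> J \<subseteq> P)"
    then obtain i j where ij: "a i \<in> I" "a j \<in> J" using meets[OF I] meets[OF J] by auto
    \<comment> \<open>The two ideals may be entered at different times; from the later one on, all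
      terms lie in both.\<close>
    define m where "m = max i j"
    have "a m \<in> I" "a m \<in> J"
      using n_sequence_mem_ideal_mono[OF a I(1) ij(1)] n_sequence_mem_ideal_mono[OF a J(1) ij(2)]
      by (simp_all add: m_def)
    then have "star_set A (ideal_gen A (a m)) (ideal_gen A (a m)) \<subseteq> star_set A I J"
      using I(1) J(1) by (intro star_set_mono ideal_gen_least)
    then have "a (Suc m) \<in> P" using a IJ unfolding n_sequence_def by blast
    then show False using P(2) by blast
  qed
  then show thesis using P(2) by (rule that)
qed

lemma n_sequence_avoiding_prime_ideal:
  assumes P: "prime_brace_ideal A P" and x: "x \<in> carrier A" "x \<notin> P"
  obtains a where "n_sequence A a" "a 0 = x" "range a \<inter> P = {}"
proof -
  let ?S = "\<lambda>x. star_set A (ideal_gen A x) (ideal_gen A x)"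
  have "\<exists>z. z \<in> carrier A - P \<and> z \<in> ?S y" if y: "y \<in> carrier A - P" for y
  proof -
    have I: "brace_ideal A (ideal_gen A y)" using y by (intro brace_ideal_ideal_gen) simp
    \<comment> \<open>Otherwise primeness would put \<open>ideal_gen A y\<close>, and with it
      \<open>y\<close>, inside \<open>P\<close>.\<close>
    then have "\<not> ?S y \<subseteq> P" using prime_brace_idealD[OF P I I] ideal_gen_self[of y] y by blast
    moreover have "?S y \<subseteq> carrier A"
      using star_set_ideal_subset[OF I] brace_idealD(1)[OF I] by (rule subset_trans)
    ultimately show ?thesis by blast
  qed
  then have "\<forall>y \<in> carrier A - P. \<exists>z. z \<in> carrier A - P \<and> z \<in> ?S y" by (intro ballI)
  then obtain f where f: "\<forall>y \<in> carrier A - P. f y \<in> carrier A - P \<and> f y \<in> ?S y"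
    by (rule bchoice[THEN exE])
  \<comment> \<open>Iterating the choice function \<open>f\<close> from \<open>x\<close> makes each
    term a successor chosen outside \<open>P\<close>.\<close>
  define a where "a = (\<lambda>n. (f ^^ n) x)"
  have a: "a n \<in> carrier A - P" for n
    using x f by (induction n) (simp_all add: a_def)
  show thesis
  proof (rule that)
    have "a (Suc n) \<in> ?S (a n)" for n using f a[of n] by (simp add: a_def)
    then show "n_sequence A a" using a unfolding n_sequence_def by blast
    show "range a \<inter> P = {}" using a by blast
  qed (simp add: a_def)
qed

section \<open>The Baer radical as an intersection\<close>

text \<open>A sequence that starts in \<open>I\<close> and avoids \<open>P\<close> never reaches
  \<open>\<zero>\<close>, because \<open>\<zero>\<close> belongs to \<open>P\<close>.\<close>

lemma baer_radical_ideal_subset_prime_ideal: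
  assumes I: "baer_radical_ideal A I" and P: "prime_brace_ideal A P"
  shows "I \<subseteq> P"
proof (rule ccontr)
  have "\<zero> \<in> P" "I \<subseteq> carrier A"
    using I P brace_idealD(1,2) unfolding prime_brace_ideal_def baer_radical_ideal_def by blast+
  assume "\<not> I \<subseteq> P"
  then obtain x where x: "x \<in> I" "x \<notin> P" by auto
  obtain a where a: "n_sequence A a" "a 0 = x" and disj: "range a \<inter> P = {}"
    using n_sequence_avoiding_prime_ideal[OF P] x \<open>I \<subseteq> carrier A\<close> by blast
  obtain i where "a i = \<zero>"
    using I a x unfolding baer_radical_ideal_def by blast
  then have "\<zero> \<in> range a" by (metis rangeI)
  then show False using disj \<open>\<zero> \<in> P\<close> by blast
qed

lemma baer_radical_ideal_Inter_prime: "baer_radical_ideal A (\<Inter>{P. prime_brace_ideal A P})"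
  unfolding baer_radical_ideal_def
proof (intro conjI allI impI)
  show "brace_ideal A (\<Inter>{P. prime_brace_ideal A P})"
    \<comment> \<open>The whole brace is prime, so the intersection is over a nonempty
      family.\<close>
    using prime_brace_ideal_carrier
    unfolding prime_brace_ideal_def by (intro brace_ideal_Inter) blast+
  fix a assume "n_sequence A a \<and> a 0 \<in> \<Inter>{P. prime_brace_ideal A P}"
  \<comment> \<open>A sequence without zeros would avoid some prime ideal, yet \<open>a 0\<close>
    lies in all of them.\<close>
  then show "\<exists>i. a i = \<zero>" using prime_ideal_avoiding_n_sequence[of a] by blast
qed

end

theorem theorem4p22:
  fixes A :: "('a, 'm) ring_scheme"
  assumes "skew_brace A"
  shows "baer_radical A = \<Inter>{P. prime_brace_ideal A P}"
proof -
  interpret skew_brace A by fact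
  show ?thesis
    unfolding baer_radical_def
    \<comment> \<open>The intersection is itself Baer radical and contains every Baer radical ideal,
      so \<open>GREATEST\<close> picks it.\<close>
    by (intro Greatest_equality baer_radical_ideal_Inter_prime Inter_greatest)
      (simp add: baer_radical_ideal_subset_prime_ideal)
qed

end
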